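(* Every holomorphic homogeneous regular domain in $\mathbb{C}^n$ is pseudoconvex.
   Context: $B^n$ is the open unit ball in $\mathbb{C}^n$ and $B^n(0,r)$ is the open ball with center $0$ and radius $r$. For a bounded domain $D\subset\mathbb{C}^n$ and $p\in D$, the squeezing function is $s_D(p)=\sup_f\,\sup\{r : B^n(0,r)\subset f(D)\}$, where the outer supremum is over all (open) injective holomorphic maps $f: D\rightarrow B^n$ with $f(p)=0$. A holomorphic homogeneous regular domain is a bounded domain $D\subset\mathbb{C}^n$ whose squeezing function has a positive lower bound: there is $c>0$ with $s_D(p)\ge c$ for all $p\in D$. *)

theory Defs
  imports "HOL-Analysis.Analysis"
begin

definition domain :: "(complex ^ 'n) set \<Rightarrow> bool" where
  "domain D \<longleftrightarrow> open D \<and> connected D \<and> D \<noteq> {}"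

(* Complex Frechet differentiability: the real derivative is complex linear. *)
definition holomorphic_map_on ::
    "(complex ^ 'n \<Rightarrow> complex ^ 'm) \<Rightarrow> (complex ^ 'n) set \<Rightarrow> bool" where
  "holomorphic_map_on f D \<longleftrightarrow>
     (\<forall>z\<in>D. \<exists>L. (f has_derivative L) (at z) \<and> (\<forall>c v. L (c *s v) = c *s L v))"

definition squeezing_maps ::
    "(complex ^ 'n) set \<Rightarrow> complex ^ 'n \<Rightarrow> (complex ^ 'n \<Rightarrow> complex ^ 'n) set" where
  "squeezing_maps D p =
     {f. holomorphic_map_on f D \<and> inj_on f D \<and> open_map (top_of_set D) euclidean f \<and>
         f ` D \<subseteq> ball 0 1 \<and> f p = 0}"

(* For a bounded domain D and p in D both suprema range over nonempty sets of reals
   bounded above by 1 (f ` D is an open neighbourhood of 0 inside the unit ball, and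
   a translated and scaled identity is admissible), so the real Sup is the intended one. *)
definition squeezing_function :: "(complex ^ 'n) set \<Rightarrow> complex ^ 'n \<Rightarrow> real" where
  "squeezing_function D p =
     (SUP f \<in> squeezing_maps D p. Sup {r. 0 < r \<and> ball 0 r \<subseteq> f ` D})"

definition holomorphic_homogeneous_regular :: "(complex ^ 'n) set \<Rightarrow> bool" where
  "holomorphic_homogeneous_regular D \<longleftrightarrow>
     domain D \<and> bounded D \<and> (\<exists>c>0. \<forall>p\<in>D. c \<le> squeezing_function D p)"

(* Continuous real-valued plurisubharmonic functions: the restriction to every complex line
   satisfies the sub-mean value inequality on each closed disc {a + t b : |t| <= 1} in D.
   Continuity ensures that the integral over the boundary circle exists. *)
definition continuous_plurisubharmonic_on ::
    "(complex ^ 'n \<Rightarrow> real) \<Rightarrow> (complex ^ 'n) set \<Rightarrow> bool" where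
  "continuous_plurisubharmonic_on u D \<longleftrightarrow>
     continuous_on D u \<and>
     (\<forall>a b. (\<lambda>t. a + t *s b) ` cball 0 1 \<subseteq> D \<longrightarrow>
        u a \<le> integral {0..2 * pi} (\<lambda>\<theta>. u (a + cis \<theta> *s b)) / (2 * pi))"

(* Existence of a continuous plurisubharmonic exhaustion function; no boundary
   regularity of D is involved. *)
definition pseudoconvex :: "(complex ^ 'n) set \<Rightarrow> bool" where
  "pseudoconvex D \<longleftrightarrow>
     open D \<and>
     (\<exists>u. continuous_plurisubharmonic_on u D \<and>
        (\<forall>c. compact (closure {z\<in>D. u z < c}) \<and> closure {z\<in>D. u z < c} \<subseteq> D))"

end

theory Submission
  imports Defs "HOL-Complex_Analysis.Conformal_Mappings"
begin

text \<open>
  The exhaustion function is \<open>- ln \<delta>\<close>, where \<open>\<delta>\<close> is the distance to the complement. Given a disc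
  \<open>a + t b\<close> in \<open>D\<close>, approximate \<open>- ln \<delta>\<close> from above on the unit circle by the real part of a
  polynomial \<open>p\<close>, and move the disc through \<open>a + t b + s exp (- p t) v\<close> with \<open>0 \<le> s \<le> 1\<close> and
  \<open>norm v \<le> 1\<close>. The boundaries of these discs stay in \<open>D\<close>. If the discs themselves stay in \<open>D\<close>, then
  their centres give \<open>\<delta> a \<ge> exp (- Re (p 0))\<close>, and the sub-mean value inequality is the mean value
  property of \<open>Re p\<close>. They do stay in \<open>D\<close> because a limit of discs in \<open>D\<close> cannot escape
  through the boundary: squeezing maps together with the Schwarz lemma confine the discs near any
  parameter whose limit is in \<open>D\<close> to a compact subset of \<open>D\<close>, uniformly in the parameter.
\<close>

subsection \<open>Harmonic polynomials on the unit circle\<close>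

text \<open>Splitting off both constant terms leaves the product of the shifted polynomials, which
  carries a factor \<open>z * cnj z = 1\<close> and falls under the induction hypothesis. The other
  terms are polynomials in \<open>z\<close> or conjugates of such, and conjugation does not change
  real parts.\<close>

lemma Re_poly_mult_cnj_on_sphere:
  "\<exists>r. \<forall>z\<in>sphere 0 1. Re (poly p z * cnj (poly q z)) = Re (poly r z)"
proof (induction p q rule: poly_induct2)
  case 0
  show ?case by (intro exI[of _ 0]) simp
next
  case (pCons a p b q)
  then obtain r where r: "\<And>z. z \<in> sphere 0 1 \<Longrightarrow> Re (poly p z * cnj (poly q z)) = Re (poly r z)"
    by blast
  show ?case
  proof (intro exI ballI)
    fix z :: complex assume z: "z \<in> sphere 0 1"
    then have zz: "z * cnj z = 1" by (simp add: complex_norm_square [symmetric])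
    have "poly (pCons a p) z * cnj (poly (pCons b q) z) =
        a * cnj b + cnj b * (z * poly p z) + cnj (cnj a * (z * poly q z))
        + (z * cnj z) * (poly p z * cnj (poly q z))"
      by (simp add: algebra_simps)
    then have "Re (poly (pCons a p) z * cnj (poly (pCons b q) z)) =
        Re (a * cnj b + cnj b * (z * poly p z) + cnj a * (z * poly q z) + poly p z * cnj (poly q z))"
      by (simp only: zz plus_complex.sel complex_cnj(1) mult_1 complex.sel cnj.sel)
    also have "\<dots> = Re (a * cnj b + cnj b * (z * poly p z) + cnj a * (z * poly q z) + poly r z)"
      using r[OF z] by (simp only: plus_complex.sel)
    also have "\<dots> = Re (poly ([:a * cnj b:] + smult (cnj b) (pCons 0 p) + smult (cnj a) (pCons 0 q) + r) z)"
      by (rule arg_cong[where f = Re]) (simp add: algebra_simps)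
    finally show "Re (poly (pCons a p) z * cnj (poly (pCons b q) z)) =
        Re (poly ([:a * cnj b:] + smult (cnj b) (pCons 0 p) + smult (cnj a) (pCons 0 q) + r) z)" .
  qed
qed

text \<open>Twice the product is \<open>Re (p * q) + Re (p * cnj q)\<close>. Hence the real parts of
  polynomials form an algebra on the circle, as Stone-Weierstrass requires.\<close>

lemma Re_poly_mult_on_sphere:
  "\<exists>r. \<forall>z\<in>sphere 0 1. Re (poly p z) * Re (poly q z) = Re (poly r z)"
proof -
  obtain r where r: "\<And>z. z \<in> sphere 0 1 \<Longrightarrow> Re (poly p z * cnj (poly q z)) = Re (poly r z)"
    using Re_poly_mult_cnj_on_sphere by blast
  have "Re (poly p z) * Re (poly q z) = Re (poly (smult (1/2) (p * q + r)) z)" if "z \<in> sphere 0 1" for z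
    using r[OF that] by (simp add: field_simps)
  then show ?thesis by blast
qed

lemma continuous_on_sphere_approx_Re_poly:
  fixes f :: "complex \<Rightarrow> real"
  assumes "continuous_on (sphere 0 1) f" "0 < e"
  obtains p where "\<And>z. z \<in> sphere 0 1 \<Longrightarrow> \<bar>f z - Re (poly p z)\<bar> < e"
proof -
  have "\<exists>g. (\<exists>p. \<forall>z\<in>sphere 0 1. g z = Re (poly p z)) \<and> (\<forall>z\<in>sphere 0 1. \<bar>f z - g z\<bar> < e)"
  proof (rule Stone_Weierstrass_HOL)
    show "\<exists>p. \<forall>z\<in>sphere 0 1. c = Re (poly p z)" for c
      by (intro exI[of _ "[:of_real c:]"]) simp
    show "continuous_on (sphere 0 1) g" if g: "\<exists>p. \<forall>z\<in>sphere 0 1. g z = Re (poly p z)"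
      for g :: "complex \<Rightarrow> real"
    proof -
      obtain p where p: "\<forall>z\<in>sphere 0 1. g z = Re (poly p z)" using g by blast
      have "continuous_on (sphere 0 1) (\<lambda>z. Re (poly p z))" by (intro continuous_intros)
      with p show ?thesis by (metis (no_types, lifting) continuous_on_cong)
    qed
    show "\<exists>p. \<forall>z\<in>sphere 0 1. g z + h z = Re (poly p z)"
      if "(\<exists>p. \<forall>z\<in>sphere 0 1. g z = Re (poly p z)) \<and> (\<exists>p. \<forall>z\<in>sphere 0 1. h z = Re (poly p z))"
      for g h :: "complex \<Rightarrow> real"
      using that by (metis poly_add plus_complex.sel(1))
    show "\<exists>p. \<forall>z\<in>sphere 0 1. g z * h z = Re (poly p z)"
      if gh: "(\<exists>p. \<forall>z\<in>sphere 0 1. g z = Re (poly p z)) \<and> (\<exists>p. \<forall>z\<in>sphere 0 1. h z = Re (poly p z))"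
      for g h :: "complex \<Rightarrow> real"
    proof -
      obtain p q where "\<forall>z\<in>sphere 0 1. g z = Re (poly p z)" "\<forall>z\<in>sphere 0 1. h z = Re (poly q z)"
        using gh by blast
      then show ?thesis using Re_poly_mult_on_sphere[of p q] by simp
    qed
    show "\<exists>g. (\<exists>p. \<forall>z\<in>sphere 0 1. g z = Re (poly p z)) \<and> g x \<noteq> g y"
      if "x \<in> sphere 0 1 \<and> y \<in> sphere 0 1 \<and> x \<noteq> y" for x y :: complex
    proof -
      \<comment> \<open>The two real parts are the real part and the negated imaginary part of the
        point, so together they separate points.\<close>
      have "Re (poly [:0, 1:] x) \<noteq> Re (poly [:0, 1:] y) \<or> Re (poly [:0, \<i>:] x) \<noteq> Re (poly [:0, \<i>:] y)"
        using that by (auto simp: complex_eq_iff)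
      then show ?thesis
        by (elim disjE) (intro exI[of _ "\<lambda>z. Re (poly _ z)"] conjI, blast, assumption)+
    qed
  qed (use assms in auto)
  then show ?thesis using that by metis
qed

text \<open>The mean value property is Cauchy's formula at the centre, where \<open>du / u\<close>
  becomes \<open>\<i> dt\<close> along the circle; the factor \<i> is why imaginary parts are
  taken.\<close>

lemma integral_Re_holomorphic_circle:
  assumes "F holomorphic_on cball 0 1"
  shows "integral {0..2 * pi} (\<lambda>\<theta>. Re (F (cis \<theta>))) = 2 * pi * Re (F 0)"
proof -
  have "((\<lambda>u. F u / (u - 0)) has_contour_integral (2 * of_real pi * \<i> * F 0)) (circlepath 0 1)"
    using assms
    by (intro Cauchy_integral_circlepath)
       (auto intro: holomorphic_on_imp_continuous_on holomorphic_on_subset)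
  then have "((\<lambda>t. F (cis t) * \<i>) has_integral (2 * of_real pi * \<i> * F 0)) {0..2 * pi}"
    by (simp add: circlepath_def has_contour_integral_part_circlepath_iff)
  from has_integral_linear[OF this bounded_linear_Im]
  have "((\<lambda>t. Re (F (cis t))) has_integral (2 * pi * Re (F 0))) {0..2 * pi}"
    by (simp add: o_def)
  then show ?thesis by (rule integral_unique)
qed

subsection \<open>Vectors and holomorphic discs\<close>

lemma norm_vector_smult:
  fixes v :: "'a::real_normed_field ^ 'n"
  shows "norm (c *s v) = norm c * norm v"
  by (simp add: norm_vec_def norm_mult L2_set_right_distrib)

lemma bounded_linear_vector_smult_left:
  "bounded_linear (\<lambda>c::complex. c *s (v :: complex ^ 'n))"
  by (rule bounded_linear_intro[where K = "norm v"])
     (auto simp: vec_eq_iff algebra_simps norm_vector_smult)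

lemma norm_vec_le_sum: "norm (x :: complex ^ 'n) \<le> (\<Sum>i\<in>UNIV. norm (x $ i))"
  unfolding norm_vec_def by (rule L2_set_le_sum) simp

text \<open>The form \<open>h *s w\<close> makes the derivative complex linear, with
  \<open>w\<close> the complex velocity. It is taken \<open>at t\<close>, not within
  \<open>S\<close>, so it composes directly with the derivatives in
  \<open>holomorphic_map_on\<close>.\<close>

definition holomorphic_disc_on :: "(complex \<Rightarrow> complex ^ 'n) \<Rightarrow> complex set \<Rightarrow> bool" where
  "holomorphic_disc_on \<phi> S \<longleftrightarrow> (\<forall>t\<in>S. \<exists>w. (\<phi> has_derivative (\<lambda>h. h *s w)) (at t))"

text \<open>Chain rule: complex linearity gives \<open>L (h *s w) = h *s L w\<close>. This makes the
  one-variable Schwarz lemma available coordinate by coordinate.\<close>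

lemma holomorphic_on_map_disc_nth:
  assumes "holomorphic_map_on f D" "holomorphic_disc_on \<phi> S" "\<phi> ` S \<subseteq> D"
  shows "(\<lambda>t. f (\<phi> t) $ i) holomorphic_on S"
  unfolding holomorphic_on_def
proof
  fix t assume t: "t \<in> S"
  obtain w where w: "(\<phi> has_derivative (\<lambda>h. h *s w)) (at t)"
    using assms(2) t by (auto simp: holomorphic_disc_on_def)
  have "\<phi> t \<in> D" using assms(3) t by blast
  then obtain L where L: "(f has_derivative L) (at (\<phi> t))" "\<And>c v. L (c *s v) = c *s L v"
    using assms(1) by (auto simp: holomorphic_map_on_def)
  have "((\<lambda>t. f (\<phi> t)) has_derivative (\<lambda>h. L (h *s w))) (at t)"
    using has_derivative_compose[OF w L(1)] .
  then have "((\<lambda>t. f (\<phi> t) $ i) has_derivative (\<lambda>h. L (h *s w) $ i)) (at t)"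
    by (rule bounded_linear.has_derivative[OF bounded_linear_vec_nth])
  then have "((\<lambda>t. f (\<phi> t) $ i) has_field_derivative (L w $ i)) (at t)"
    by (simp add: has_field_derivative_def L(2) mult.commute[of _ "L w $ i"])
  then show "(\<lambda>t. f (\<phi> t) $ i) field_differentiable at t within S"
    using field_differentiable_at_within field_differentiable_def by blast
qed

text \<open>Two values of \<open>h\<close> differ by less than 2, so half the increment from the
  centre, rescaled to the unit disc, satisfies the hypotheses of the Schwarz lemma.\<close>

lemma holomorphic_bounded_Lipschitz_center:
  assumes "h holomorphic_on ball a \<rho>" "0 < \<rho>"
    and bd: "\<And>z. z \<in> ball a \<rho> \<Longrightarrow> norm (h z) < 1"
    and t: "t \<in> ball a \<rho>"
  shows "norm (h t - h a) \<le> 2 * dist a t / \<rho>"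
proof -
  define g where "g z = (h (a + of_real \<rho> * z) - h a) / 2" for z
  have mem: "a + of_real \<rho> * z \<in> ball a \<rho>" if "norm z < 1" for z
    using that \<open>0 < \<rho>\<close> by (simp add: dist_norm norm_mult)
  have "(\<lambda>z. h (a + of_real \<rho> * z)) holomorphic_on ball 0 1"
    using mem by (intro holomorphic_on_compose_gen[OF _ assms(1), unfolded o_def] holomorphic_intros) auto
  then have hol: "g holomorphic_on ball 0 1"
    unfolding g_def by (intro holomorphic_intros) auto
  have lt: "norm (g z) < 1" if "norm z < 1" for z
  proof -
    have "norm (h (a + of_real \<rho> * z) - h a) < 1 + 1"
      using bd[OF mem[OF that]] bd[of a] \<open>0 < \<rho>\<close>
      by (intro le_less_trans[OF norm_triangle_ineq4] add_strict_mono) auto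
    then show ?thesis by (simp add: g_def norm_divide)
  qed
  let ?z = "(t - a) / of_real \<rho>"
  have z: "norm ?z = dist a t / \<rho>" using \<open>0 < \<rho>\<close> by (simp add: norm_divide dist_norm norm_minus_commute)
  then have "norm ?z < 1" using t \<open>0 < \<rho>\<close> by simp
  then have "norm (g ?z) \<le> norm ?z"
    by (intro Schwarz_Lemma(1)[OF hol _ lt]) (auto simp: g_def)
  moreover have "g ?z = (h t - h a) / 2" using \<open>0 < \<rho>\<close> by (simp add: g_def)
  ultimately show ?thesis using z by (simp add: norm_divide field_simps)
qed

subsection \<open>Limits of discs in domains with squeezing maps\<close>

lemma squeezing_maps_nonempty:
  assumes "domain D" "bounded D"
  shows "squeezing_maps D p \<noteq> {}"
proof -
  obtain R where R: "R > 0" "\<And>z. z \<in> D \<Longrightarrow> norm z \<le> R"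
    using \<open>bounded D\<close> bounded_pos by metis
  \<comment> \<open>On \<open>D\<close> the norm of \<open>z - p\<close> is at most
    \<open>R + norm p\<close>, so this scaling sends \<open>D\<close> into the open unit
    ball.\<close>
  define k where "k = inverse (R + norm p + 1)"
  have k: "k > 0" using R(1) by (simp add: k_def add_pos_nonneg)
  define f where "f z = k *\<^sub>R (z - p)" for z
  have der: "(f has_derivative (\<lambda>h. k *\<^sub>R h)) (at z)" for z
    unfolding f_def by (auto intro!: derivative_eq_intros)
  have "holomorphic_map_on f D"
    unfolding holomorphic_map_on_def
  proof (intro ballI exI conjI allI)
    show "(f has_derivative (\<lambda>h. k *\<^sub>R h)) (at z)" for z by (rule der)
    show "k *\<^sub>R (c *s v) = c *s k *\<^sub>R v" for c :: complex and v :: "complex ^ 'a"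
      by (simp add: vec_eq_iff)
  qed
  moreover have "inj_on f D" using k by (auto simp: inj_on_def f_def)
  moreover have "open_map (top_of_set D) euclidean f"
    unfolding open_map_def
  proof (intro allI impI)
    fix U assume "openin (top_of_set D) U"
    then have "open U" using \<open>domain D\<close> by (simp add: domain_def openin_open_eq)
    then have "open ((\<lambda>z. - (k *\<^sub>R p) + z) ` ((\<lambda>z. k *\<^sub>R z) ` U))"
      using k by (intro open_translation open_scaling) auto
    moreover have "(\<lambda>z. - (k *\<^sub>R p) + z) ` ((\<lambda>z. k *\<^sub>R z) ` U) = f ` U"
      by (auto simp: f_def image_image algebra_simps)
    ultimately show "openin euclidean (f ` U)" by simp
  qed
  moreover have "f ` D \<subseteq> ball 0 1"
  proof (intro image_subsetI)
    fix z assume "z \<in> D"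
    then have "norm (z - p) < R + norm p + 1"
      using R(2)[of z] norm_triangle_ineq4[of z p] by linarith
    moreover have "0 < R + norm p + 1" using R(1) by (simp add: add_pos_nonneg)
    ultimately have "k * norm (z - p) < 1" unfolding k_def by (simp add: field_simps)
    then show "f z \<in> ball 0 1" using k by (simp add: f_def)
  qed
  ultimately have "f \<in> squeezing_maps D p" by (simp add: squeezing_maps_def f_def)
  then show ?thesis by blast
qed

lemma squeezing_function_less_obtains_map:
  assumes "domain D" "bounded D" "p \<in> D" "c < squeezing_function D p"
  obtains f where "f \<in> squeezing_maps D p" "ball 0 c \<subseteq> f ` D"
proof -
  obtain y where "y \<in> (\<lambda>f. Sup {r. 0 < r \<and> ball 0 r \<subseteq> f ` D}) ` squeezing_maps D p" "c < y"
    using less_cSupE[OF assms(4)[unfolded squeezing_function_def]]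
      squeezing_maps_nonempty[OF assms(1,2)] by auto
  then obtain f where f: "f \<in> squeezing_maps D p" and c: "c < Sup {r. 0 < r \<and> ball 0 r \<subseteq> f ` D}"
    by blast
  have "open (f ` D)" "0 \<in> f ` D"
    using f \<open>p \<in> D\<close> by (auto simp: squeezing_maps_def open_map_def)
  then have "{r. 0 < r \<and> ball 0 r \<subseteq> f ` D} \<noteq> {}"
    by (auto elim: openE)
  from less_cSupE[OF c this] obtain r where "c < r" "ball 0 r \<subseteq> f ` D"
    by blast
  then show ?thesis using that[OF f] subset_ball[of c r 0] by auto
qed

text \<open>The lower bound on the squeezing function, freed of suprema: one radius serves all
  centres and is realised by an actual map.\<close>

definition uniformly_squeezed :: "real \<Rightarrow> (complex ^ 'n) set \<Rightarrow> bool" where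
  "uniformly_squeezed c D \<longleftrightarrow> (\<forall>p\<in>D. \<exists>f\<in>squeezing_maps D p. ball 0 c \<subseteq> f ` D)"

lemma holomorphic_map_on_imp_continuous_on:
  "holomorphic_map_on f D \<Longrightarrow> continuous_on D f"
  unfolding holomorphic_map_on_def
  by (meson continuous_at_imp_continuous_on has_derivative_continuous)

text \<open>
  The squeezing map centred at the limit point \<open>\<psi> a\<close> carries all the discs into the unit
  ball, and by the Schwarz lemma it carries a smaller disc about \<open>a\<close>, of radius depending
  only on \<open>c\<close> and \<open>\<rho>\<close>, into a closed ball whose preimage is compact.
\<close>
lemma limit_of_discs_in_domain:
  fixes D :: "(complex ^ 'n) set"
  assumes "uniformly_squeezed c D" "0 < c" "0 < \<rho>"
    and disc: "\<And>k::nat. holomorphic_disc_on (\<phi> k) (ball a \<rho>)" "\<And>k. \<phi> k ` ball a \<rho> \<subseteq> D"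
    and lim: "\<And>t. t \<in> ball a \<rho> \<Longrightarrow> (\<lambda>k. \<phi> k t) \<longlonglongrightarrow> \<psi> t"
    and "\<psi> a \<in> D" and t: "t \<in> ball a \<rho>" "4 * CARD('n) * dist a t \<le> c * \<rho>"
  shows "\<psi> t \<in> D"
proof -
  obtain f where f: "f \<in> squeezing_maps D (\<psi> a)" and sub: "ball 0 c \<subseteq> f ` D"
    using assms(1) \<open>\<psi> a \<in> D\<close> by (auto simp: uniformly_squeezed_def)
  have hol: "holomorphic_map_on f D" and inj: "inj_on f D" and om: "open_map (top_of_set D) euclidean f"
    and ball: "f ` D \<subseteq> ball 0 1" and f0: "f (\<psi> a) = 0"
    using f by (auto simp: squeezing_maps_def)
  have contf: "continuous_on D f" using hol by (rule holomorphic_map_on_imp_continuous_on)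
  obtain g where g: "homeomorphism D (f ` D) f g"
  proof (rule homeomorphism_injective_open_map[OF contf refl inj])
    fix U assume "openin (top_of_set D) U"
    then have "open (f ` U)" "f ` U \<subseteq> f ` D" using om by (auto simp: open_map_def dest!: openin_imp_subset)
    then show "openin (top_of_set (f ` D)) (f ` U)" by (simp add: open_subset)
  qed
  \<comment> \<open>The radius is \<open>c / 2\<close> for the oscillation between \<open>a\<close>
    and \<open>t\<close>, plus \<open>c / 4\<close> for the images of the centres, which tend to 0;
    the sum stays below \<open>c\<close>.\<close>
  define K where "K = g ` cball 0 (3 * c / 4)"
  have c1: "cball 0 (3 * c / 4) \<subseteq> f ` D" using sub \<open>0 < c\<close> by (force simp: subset_iff)
  have "compact K" unfolding K_def
    using c1 g by (intro compact_continuous_image) (auto simp: homeomorphism_def intro: continuous_on_subset)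
  have "K \<subseteq> D" using image_mono[OF c1, of g] homeomorphism_image2[OF g] by (simp add: K_def)
  have Lip: "norm (f (\<phi> k t) - f (\<phi> k a)) \<le> c / 2" for k
  proof -
    have "norm ((f (\<phi> k t) - f (\<phi> k a)) $ i) \<le> 2 * dist a t / \<rho>" for i
      unfolding vector_minus_component
    proof (rule holomorphic_bounded_Lipschitz_center[where h = "\<lambda>t. f (\<phi> k t) $ i"])
      show "(\<lambda>t. f (\<phi> k t) $ i) holomorphic_on ball a \<rho>"
        by (rule holomorphic_on_map_disc_nth[OF hol disc])
      show "norm (f (\<phi> k z) $ i) < 1" if "z \<in> ball a \<rho>" for z
      proof -
        have "f (\<phi> k z) \<in> ball 0 1" using disc(2)[of k] ball that by blast
        then show ?thesis using Finite_Cartesian_Product.norm_nth_le[of "f (\<phi> k z)" i] by simp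
      qed
    qed (use assms in auto)
    \<comment> \<open>Summing the bound over the coordinates costs a factor \<open>CARD('n)\<close>;
      this and the \<open>c / 2\<close> aimed at explain the constant \<open>4 * CARD('n)\<close> in
      the hypothesis.\<close>
    then have "norm (f (\<phi> k t) - f (\<phi> k a)) \<le> (\<Sum>i\<in>(UNIV::'n set). 2 * dist a t / \<rho>)"
      by (intro order_trans[OF norm_vec_le_sum] sum_mono)
    also have "\<dots> \<le> c / 2" using t(2) \<open>0 < \<rho>\<close> by (simp add: field_simps)
    finally show ?thesis .
  qed
  have a: "a \<in> ball a \<rho>" using \<open>0 < \<rho>\<close> by simp
  have "(\<lambda>k. f (\<phi> k a)) \<longlonglongrightarrow> f (\<psi> a)"
    using disc(2) a
    by (intro continuous_on_tendsto_compose[OF contf lim[OF a] \<open>\<psi> a \<in> D\<close>] always_eventually) blast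
  then have "\<forall>\<^sub>F k in sequentially. dist (f (\<phi> k a)) 0 < c / 4"
    using f0 \<open>0 < c\<close> by (auto dest!: tendstoD[where e = "c / 4"])
  then have "\<forall>\<^sub>F k in sequentially. \<phi> k t \<in> K"
  proof eventually_elim
    case (elim k)
    have "norm (f (\<phi> k t)) \<le> norm (f (\<phi> k t) - f (\<phi> k a)) + norm (f (\<phi> k a))"
      by (metis diff_add_cancel norm_triangle_ineq)
    then have "f (\<phi> k t) \<in> cball 0 (3 * c / 4)" using elim Lip[of k] by simp
    moreover have "\<phi> k t \<in> D" using disc(2)[of k] t(1) by blast
    then have "g (f (\<phi> k t)) = \<phi> k t" using g by (simp add: homeomorphism_def)
    ultimately show ?case unfolding K_def by (metis imageI)
  qed
  then have "\<psi> t \<in> K"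
    using Lim_in_closed_set[OF compact_imp_closed[OF \<open>compact K\<close>] _ _ lim[OF t(1)]] by simp
  then show ?thesis using \<open>K \<subseteq> D\<close> by blast
qed

text \<open>The interior parameters with limit in \<open>D\<close> form a set that is open by
  continuity, relatively closed by the uniform estimate \<open>limit_of_discs_in_domain\<close>, and
  nonempty since the boundary circle lands in the open set \<open>D\<close>. Connectedness of the
  disc does the rest.\<close>

lemma limit_disc_in_domain:
  fixes D :: "(complex ^ 'n) set"
  assumes "uniformly_squeezed c D" "0 < c" "open D"
    and disc: "\<And>k::nat. holomorphic_disc_on (\<phi> k) (ball 0 1)" "\<And>k. \<phi> k ` ball 0 1 \<subseteq> D"
    and lim: "\<And>t. t \<in> ball 0 1 \<Longrightarrow> (\<lambda>k. \<phi> k t) \<longlonglongrightarrow> \<psi> t"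
    and cont: "continuous_on (cball 0 1) \<psi>" and bdry: "\<psi> ` sphere 0 1 \<subseteq> D"
  shows "\<psi> ` cball 0 1 \<subseteq> D"
proof -
  define A where "A = {t \<in> ball 0 1. \<psi> t \<in> D}"
  have op: "openin (top_of_set (ball 0 1)) A"
  proof -
    have "continuous_on (ball 0 1) \<psi>" using cont by (rule continuous_on_subset) auto
    then have "openin (top_of_set (ball 0 1)) (ball 0 1 \<inter> \<psi> -` D)"
      using \<open>open D\<close> by (rule continuous_openin_preimage_gen)
    moreover have "ball 0 1 \<inter> \<psi> -` D = A" by (auto simp: A_def)
    ultimately show ?thesis by simp
  qed
  have cl: "closedin (top_of_set (ball 0 1)) A"
    unfolding closedin_limpt
  proof (intro conjI allI impI)
    show "A \<subseteq> ball 0 1" by (auto simp: A_def)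
    fix t :: complex assume "t islimpt A \<and> t \<in> ball 0 1"
    then have lp: "t islimpt A" and t: "norm t < 1" by auto
    \<comment> \<open>Half the distance from \<open>t\<close> to the circle: discs of radius \<rho>
      about centres within \<rho> of \<open>t\<close> stay in the unit disc.\<close>
    define \<rho> where "\<rho> = (1 - norm t) / 2"
    have \<rho>: "0 < \<rho>" using t by (simp add: \<rho>_def)
    \<comment> \<open>The reach of the estimate does not depend on its centre, so a point
      \<open>s\<close> of \<open>A\<close> this close to \<open>t\<close> can serve as
      centre.\<close>
    define d where "d = min \<rho> (c * \<rho> / (4 * CARD('n)))"
    have "0 < d" using \<rho> \<open>0 < c\<close> by (simp add: d_def)
    then obtain s where s: "s \<in> A" "dist s t < d" using lp by (meson islimpt_approachable)
    have sub: "ball s \<rho> \<subseteq> ball 0 1"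
    proof
      fix z assume "z \<in> ball s \<rho>"
      moreover have "dist s t < \<rho>" using s(2) by (simp add: d_def)
      moreover have "norm z \<le> norm t + dist s t + dist s z"
        by (smt (verit) dist_commute dist_norm norm_triangle_sub dist_triangle)
      ultimately show "z \<in> ball 0 1" by (simp add: \<rho>_def)
    qed
    have "\<psi> t \<in> D"
    proof (rule limit_of_discs_in_domain[OF assms(1,2) \<rho>])
      show "holomorphic_disc_on (\<phi> k) (ball s \<rho>)" for k
        using disc(1)[of k] sub by (auto simp: holomorphic_disc_on_def)
      show "\<phi> k ` ball s \<rho> \<subseteq> D" for k using disc(2)[of k] sub by blast
      show "(\<lambda>k. \<phi> k z) \<longlonglongrightarrow> \<psi> z" if "z \<in> ball s \<rho>" for z using lim that sub by blast
      show "\<psi> s \<in> D" using s(1) by (simp add: A_def)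
      show "t \<in> ball s \<rho>" using s(2) by (simp add: d_def)
      have "dist s t \<le> c * \<rho> / (4 * CARD('n))" using s(2) by (simp add: d_def)
      then show "4 * CARD('n) * dist s t \<le> c * \<rho>" by (simp add: field_simps)
    qed
    then show "t \<in> A" using t by (simp add: A_def)
  qed
  have "A \<noteq> {}"
  proof -
    have "\<psi> 1 \<in> D" using bdry by auto
    \<comment> \<open>Interior points approaching the boundary point 1 radially eventually have
      their images in \<open>D\<close>.\<close>
    moreover have "(\<lambda>k. \<psi> (of_real (1 - inverse (Suc k)))) \<longlonglongrightarrow> \<psi> 1"
    proof (rule continuous_on_tendsto_compose[OF cont])
      have "(\<lambda>k. of_real (1 - inverse (Suc k))) \<longlonglongrightarrow> (of_real (1 - 0) :: complex)"
        by (intro tendsto_intros LIMSEQ_inverse_real_of_nat)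
      then show "(\<lambda>k. of_real (1 - inverse (Suc k))) \<longlonglongrightarrow> (1 :: complex)" by simp
      show "\<forall>\<^sub>F k in sequentially. complex_of_real (1 - inverse (real (Suc k))) \<in> cball 0 1"
        by (intro always_eventually allI)
           (simp only: mem_cball dist_0_norm norm_of_real, simp add: divide_simps)
    qed simp
    ultimately have "\<forall>\<^sub>F k in sequentially. \<psi> (of_real (1 - inverse (Suc k))) \<in> D"
      using \<open>open D\<close> topological_tendstoD by blast
    then obtain k where k: "\<psi> (of_real (1 - inverse (real (Suc k)))) \<in> D"
      using eventually_sequentially by force
    have "norm (complex_of_real (1 - inverse (real (Suc k)))) < 1"
      by (simp only: norm_of_real) (simp add: divide_simps)
    with k have "complex_of_real (1 - inverse (real (Suc k))) \<in> A"
      unfolding A_def by simp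
    then show ?thesis by blast
  qed
  moreover have "connected (ball (0::complex) 1)" by simp
  ultimately have "A = ball 0 1" using op cl connected_clopen by blast
  then have "\<psi> ` ball 0 1 \<subseteq> D" by (auto simp: A_def)
  moreover have "cball (0::complex) 1 = ball 0 1 \<union> sphere 0 1" by auto
  ultimately show ?thesis using bdry by (simp add: image_Un)
qed

text \<open>Continuity principle. The parameters of discs inside \<open>D\<close> form a closed set
  by \<open>limit_disc_in_domain\<close>, and so do those of discs meeting the complement, by
  compactness. Connectedness of the parameter interval and the disc at 0 exclude the latter.\<close>

lemma Kontinuitaetssatz:
  fixes D :: "(complex ^ 'n) set" and \<Phi> :: "real \<Rightarrow> complex \<Rightarrow> complex ^ 'n"
  assumes "uniformly_squeezed c D" "0 < c" "open D"
    and cont: "continuous_on ({0..1} \<times> cball 0 1) (\<lambda>(s, t). \<Phi> s t)"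
    and disc: "\<And>s. s \<in> {0..1} \<Longrightarrow> holomorphic_disc_on (\<Phi> s) (ball 0 1)"
    and bdry: "\<And>s. s \<in> {0..1} \<Longrightarrow> \<Phi> s ` sphere 0 1 \<subseteq> D"
    and base: "\<Phi> 0 ` cball 0 1 \<subseteq> D"
  shows "\<Phi> 1 ` cball 0 1 \<subseteq> D"
proof -
  define S where "S = {s \<in> {0..1}. \<Phi> s ` cball 0 1 \<subseteq> D}"
  \<comment> \<open>A projection of a compact set, hence closed; this encodes the openness of
    \<open>S\<close> in the interval.\<close>
  define T where "T = fst ` (({0..1} \<times> cball 0 1) \<inter> (\<lambda>(s, t). \<Phi> s t) -` (- D))"
  have slice: "continuous_on (cball 0 1) (\<Phi> s)" if "s \<in> {0..1}" for s
  proof -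
    have "continuous_on (cball 0 1) (\<lambda>t. case (s, t) of (s, t) \<Rightarrow> \<Phi> s t)"
      using that by (intro continuous_on_compose2[OF cont] continuous_intros) auto
    then show ?thesis by simp
  qed
  have "compact (({0..1} \<times> cball 0 1) \<inter> (\<lambda>(s, t). \<Phi> s t) -` (- D))"
  proof -
    have "closed (({0..1} \<times> cball 0 1) \<inter> (\<lambda>(s, t). \<Phi> s t) -` (- D))"
      using \<open>open D\<close> by (intro continuous_closed_preimage[OF cont] closed_Times) auto
    moreover have "compact ({0..1::real} \<times> cball (0::complex) 1)" by (intro compact_Times) auto
    ultimately show ?thesis
      by (metis compact_Int_closed inf.left_idem)
  qed
  then have "compact T" unfolding T_def by (intro compact_continuous_image continuous_intros)
  then have T: "closed T" by (rule compact_imp_closed)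
  have S: "closed S"
    unfolding closed_sequential_limits
  proof (intro allI impI)
    fix x s assume "(\<forall>k. x k \<in> S) \<and> x \<longlonglongrightarrow> s"
    then have x: "\<And>k. x k \<in> S" and xs: "x \<longlonglongrightarrow> s" by auto
    have x01: "x k \<in> {0..1}" for k using x[of k] by (simp add: S_def)
    have s: "s \<in> {0..1}" using closed_sequentially[OF _ x01 xs] by simp
    have "\<Phi> s ` cball 0 1 \<subseteq> D"
    proof (rule limit_disc_in_domain[OF assms(1-3)])
      show "holomorphic_disc_on (\<Phi> (x k)) (ball 0 1)" for k using disc x01 by blast
      show "\<Phi> (x k) ` ball 0 1 \<subseteq> D" for k using x[of k] ball_subset_cball unfolding S_def by blast
      show "(\<lambda>k. \<Phi> (x k) t) \<longlonglongrightarrow> \<Phi> s t" if "t \<in> ball 0 1" for t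
      proof -
        have "(\<lambda>k. (x k, t)) \<longlonglongrightarrow> (s, t)" using xs by (intro tendsto_intros)
        then show ?thesis
          using continuous_on_tendsto_compose[OF cont, of "\<lambda>k. (x k, t)" "(s, t)" sequentially] that s x01
          by (auto simp: less_imp_le)
      qed
      show "continuous_on (cball 0 1) (\<Phi> s)" using s by (rule slice)
      show "\<Phi> s ` sphere 0 1 \<subseteq> D" using s by (rule bdry)
    qed
    then show "s \<in> S" using s by (simp add: S_def)
  qed
  have "{0..1} \<subseteq> S \<union> T" "S \<inter> T \<inter> {0..1} = {}" by (force simp: S_def T_def)+
  moreover have "S \<inter> {0..1} \<noteq> {}" using base by (auto simp: S_def)
  moreover have "connected {0..1::real}" by simp
  ultimately have "T \<inter> {0..1} = {}" using S T unfolding connected_closed by blast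
  with \<open>{0..1} \<subseteq> S \<union> T\<close> have "1 \<in> S" by (metis IntI Un_iff atLeastAtMost_iff emptyE order_refl subsetD zero_le_one)
  then show ?thesis by (simp add: S_def)
qed

subsection \<open>Plurisubharmonicity of the boundary distance\<close>

text \<open>A point \<open>x\<close> outside \<open>D\<close> closer to \<open>a\<close> than the
  bound would be the centre of the last disc of a family starting at the given disc. On the boundary
  circle the discs are displaced by less than the distance to the complement, so the continuity
  principle puts \<open>x\<close> in \<open>D\<close>.\<close>

lemma infdist_disc_center_ge:
  fixes D :: "(complex ^ 'n) set"
  assumes us: "uniformly_squeezed c D" "0 < c" "open D" and "- D \<noteq> {}"
    and disc: "(\<lambda>t. a + t *s b) ` cball 0 1 \<subseteq> D"
    and lt: "\<And>t. t \<in> sphere 0 1 \<Longrightarrow> exp (- Re (poly p t)) < infdist (a + t *s b) (- D)"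
  shows "exp (- Re (poly p 0)) \<le> infdist a (- D)"
proof -
  have "exp (- Re (poly p 0)) \<le> dist a x" if x: "x \<in> - D" for x
  proof (rule ccontr)
    assume "\<not> exp (- Re (poly p 0)) \<le> dist a x"
    then have less: "norm (x - a) < exp (- Re (poly p 0))" by (simp add: dist_norm norm_minus_commute)
    \<comment> \<open>Chosen so that \<open>exp (- poly p 0) *s v = x - a\<close>, which makes
      \<open>x\<close> the centre of the disc at parameter 1; closeness of \<open>x\<close> to
      \<open>a\<close> gives \<open>norm v \<le> 1\<close>.\<close>
    define v where "v = exp (poly p 0) *s (x - a)"
    have "norm v = exp (Re (poly p 0)) * norm (x - a)" unfolding v_def norm_vector_smult by simp
    also have "\<dots> \<le> exp (Re (poly p 0)) * exp (- Re (poly p 0))"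
      using less by (intro mult_left_mono) auto
    finally have v: "norm v \<le> 1" by (simp add: exp_minus)
    define \<Phi> where "\<Phi> s t = a + t *s b + (of_real s * exp (- poly p t)) *s v" for s :: real and t
    have "\<Phi> 1 ` cball 0 1 \<subseteq> D"
    proof (rule Kontinuitaetssatz[OF us])
      show "continuous_on ({0..1} \<times> cball 0 1) (\<lambda>(s, t). \<Phi> s t)"
        unfolding \<Phi>_def case_prod_unfold
        by (intro continuous_intros bounded_linear.continuous_on[OF bounded_linear_vector_smult_left])
      show "holomorphic_disc_on (\<Phi> s) (ball 0 1)" for s
        unfolding holomorphic_disc_on_def
      proof
        fix t :: complex
        define d where "d = of_real s * (exp (- poly p t) * (- poly (pderiv p) t))"
        have "((\<lambda>t. of_real s * exp (- poly p t)) has_field_derivative d) (at t)"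
          unfolding d_def by (auto intro!: derivative_eq_intros)
        then have d: "((\<lambda>t. of_real s * exp (- poly p t)) has_derivative (\<lambda>h. d * h)) (at t)"
          by (simp add: has_field_derivative_def)
        have "(\<Phi> s has_derivative (\<lambda>h. 0 + h *s b + (d * h) *s v)) (at t)"
          unfolding \<Phi>_def
          by (intro has_derivative_add has_derivative_const has_derivative_ident
              bounded_linear.has_derivative[OF bounded_linear_vector_smult_left] d)
        moreover have "(\<lambda>h. 0 + h *s b + (d * h) *s v) = (\<lambda>h. h *s (b + d *s v))"
          by (auto simp: vec_eq_iff algebra_simps)
        ultimately have "(\<Phi> s has_derivative (\<lambda>h. h *s (b + d *s v))) (at t)" by (simp only:)
        then show "\<exists>w. (\<Phi> s has_derivative (\<lambda>h. h *s w)) (at t)" by blast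
      qed
      show "\<Phi> s ` sphere 0 1 \<subseteq> D" if "s \<in> {0..1}" for s
      proof (intro image_subsetI, rule ccontr)
        fix t :: complex assume t: "t \<in> sphere 0 1" and "\<Phi> s t \<notin> D"
        then have "infdist (a + t *s b) (- D) \<le> dist (a + t *s b) (\<Phi> s t)"
          by (intro infdist_le) simp
        also have "\<dots> = s * exp (- Re (poly p t)) * norm v"
          using that by (simp add: \<Phi>_def dist_norm norm_vector_smult norm_mult)
        also have "\<dots> \<le> 1 * exp (- Re (poly p t)) * 1"
          using that v by (intro mult_mono) auto
        finally show False using lt[OF t] by simp
      qed
      show "\<Phi> 0 ` cball 0 1 \<subseteq> D" using disc by (simp add: \<Phi>_def)
    qed
    then have "\<Phi> 1 0 \<in> D" by (auto simp: image_subset_iff)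
    moreover have "\<Phi> 1 0 = x"
    proof -
      have "exp (- poly p 0) * exp (poly p 0) = 1" by (simp add: exp_minus)
      then have "exp (- poly p 0) *s v = x - a"
        unfolding v_def by (simp add: vector_smult_assoc)
      then show ?thesis by (simp add: \<Phi>_def)
    qed
    ultimately show False using x by simp
  qed
  then show ?thesis
    unfolding infdist_notempty[OF \<open>- D \<noteq> {}\<close>] by (intro cINF_greatest \<open>- D \<noteq> {}\<close>)
qed

text \<open>If \<open>Re p\<close> lies above \<open>u\<close> on the circle, the distance bound at
  the centre gives \<open>u 0 \<le> Re (p 0)\<close>, and the right-hand side is the circle mean of
  \<open>Re p\<close>. Taking \<open>Re p\<close> within \<open>e\<close> of \<open>u\<close> yields
  the inequality up to \<open>e\<close>.\<close>

lemma continuous_plurisubharmonic_on_neg_ln_infdist: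
  fixes D :: "(complex ^ 'n) set"
  assumes us: "uniformly_squeezed c D" "0 < c" "open D" and ne: "- D \<noteq> {}"
  shows "continuous_plurisubharmonic_on (\<lambda>z. - ln (infdist z (- D))) D"
  unfolding continuous_plurisubharmonic_on_def
proof (intro conjI allI impI)
  have pos: "infdist z (- D) > 0" if "z \<in> D" for z
    using that \<open>open D\<close> ne by (intro infdist_pos_not_in_closed) auto
  show cont: "continuous_on D (\<lambda>z. - ln (infdist z (- D)))"
    by (intro continuous_intros) (use pos in force)
  fix a b :: "complex ^ 'n"
  assume disc: "(\<lambda>t. a + t *s b) ` cball 0 1 \<subseteq> D"
  define u where "u t = - ln (infdist (a + t *s b) (- D))" for t
  let ?I = "integral {0..2 * pi} (\<lambda>\<theta>. u (cis \<theta>))"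
  have inD: "a + t *s b \<in> D" if "norm t \<le> 1" for t
    using disc that by (auto simp: image_subset_iff)
  have contu: "continuous_on (sphere 0 1) u"
    unfolding u_def
    by (intro continuous_on_compose2[OF cont] continuous_intros
        bounded_linear.continuous_on[OF bounded_linear_vector_smult_left])
       (auto simp: inD)
  have intu: "(\<lambda>\<theta>. u (cis \<theta>)) integrable_on {0..2 * pi}"
    by (intro integrable_continuous_real continuous_on_compose2[OF contu] continuous_intros) auto
  have "- ln (infdist a (- D)) \<le> ?I / (2 * pi) + e" if "0 < e" for e
  proof -
    obtain q where q: "\<And>t. t \<in> sphere 0 1 \<Longrightarrow> \<bar>u t - Re (poly q t)\<bar> < e / 2"
      using continuous_on_sphere_approx_Re_poly[OF contu, of "e / 2"] \<open>0 < e\<close> by auto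
    \<comment> \<open>Raising an \<open>e / 2\<close> approximation by \<open>e / 2\<close> makes it
      one-sided: strictly above \<open>u\<close> and at most \<open>e\<close> above.\<close>
    define p where "p = q + [:of_real (e / 2):]"
    have p: "u t < Re (poly p t)" "Re (poly p t) \<le> u t + e" if "t \<in> sphere 0 1" for t
      using q[OF that] unfolding p_def abs_less_iff by (simp_all; linarith)+
    have "exp (- Re (poly p 0)) \<le> infdist a (- D)"
    proof (rule infdist_disc_center_ge[OF us ne disc])
      fix t :: complex assume t: "t \<in> sphere 0 1"
      have "exp (- Re (poly p t)) < exp (- u t)" using p(1)[OF t] by simp
      also have "\<dots> = infdist (a + t *s b) (- D)"
        using pos[OF inD[of t]] t by (simp add: u_def)
      finally show "exp (- Re (poly p t)) < infdist (a + t *s b) (- D)" .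
    qed
    then have "ln (exp (- Re (poly p 0))) \<le> ln (infdist a (- D))"
      using pos[OF inD[of 0]] by (subst ln_le_cancel_iff) auto
    then have "- ln (infdist a (- D)) \<le> Re (poly p 0)" by simp
    also have "\<dots> = integral {0..2 * pi} (\<lambda>\<theta>. Re (poly p (cis \<theta>))) / (2 * pi)"
      by (subst integral_Re_holomorphic_circle) (auto intro!: holomorphic_intros)
    also have "\<dots> \<le> integral {0..2 * pi} (\<lambda>\<theta>. u (cis \<theta>) + e) / (2 * pi)"
      using p(2)
      by (intro divide_right_mono integral_le integrable_add[OF intu]
          integrable_continuous_real continuous_intros) auto
    also have "\<dots> = ?I / (2 * pi) + e"
      using intu by (subst integral_add) (auto simp: field_simps)
    finally show ?thesis .
  qed
  then have "- ln (infdist a (- D)) \<le> ?I / (2 * pi)" by (rule field_le_epsilon)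
  then show "- ln (infdist a (- D)) \<le>
      integral {0..2 * pi} (\<lambda>\<theta>. - ln (infdist (a + cis \<theta> *s b) (- D))) / (2 * pi)"
    by (simp add: u_def)
qed

section \<open>The boundary distance exhaustion of a holomorphic homogeneous regular domain\<close>

theorem corollary4p5:
  fixes D :: "(complex ^ 'n) set"
  assumes "holomorphic_homogeneous_regular D"
  shows "pseudoconvex D"
proof -
  obtain c where dom: "domain D" and bdd: "bounded D" and c: "c > 0" "\<And>p. p \<in> D \<Longrightarrow> c \<le> squeezing_function D p"
    using assms by (auto simp: holomorphic_homogeneous_regular_def)
  \<comment> \<open>Halving \<open>c\<close> turns the bound into a strict one, so that a map
    realising the radius exists.\<close>
  have us: "uniformly_squeezed (c / 2) D"
    unfolding uniformly_squeezed_def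
  proof
    fix p assume p: "p \<in> D"
    have "c / 2 < squeezing_function D p" using c(1) c(2)[OF p] by linarith
    then show "\<exists>f\<in>squeezing_maps D p. ball 0 (c / 2) \<subseteq> f ` D"
      using squeezing_function_less_obtains_map[OF dom bdd p] by metis
  qed
  have "open D" using dom by (simp add: domain_def)
  \<comment> \<open>\<open>infdist\<close> to the empty set is 0 by convention, so \<open>?u\<close>
    has its intended meaning only if the complement is nonempty.\<close>
  have "D \<noteq> UNIV" using bdd not_bounded_UNIV by metis
  then have ne: "- D \<noteq> {}" by auto
  let ?u = "\<lambda>z. - ln (infdist z (- D))"
  have sublevel: "closure {z \<in> D. ?u z < k} \<subseteq> D" for k
  proof -
    \<comment> \<open>The larger set is closed in the whole space and misses the complement of
      \<open>D\<close>, where \<open>infdist\<close> vanishes; so the closure of the sublevel set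
      cannot reach the boundary.\<close>
    have "{z \<in> D. ?u z < k} \<subseteq> {z. exp (- k) \<le> infdist z (- D)}"
    proof clarify
      fix z assume z: "z \<in> D" "?u z < k"
      then have "infdist z (- D) > 0" using \<open>open D\<close> ne by (intro infdist_pos_not_in_closed) auto
      then show "exp (- k) \<le> infdist z (- D)" using z(2) by (simp add: ln_ge_iff [symmetric])
    qed
    moreover have "closed {z. exp (- k) \<le> infdist z (- D)}"
      by (intro closed_Collect_le continuous_intros)
    ultimately have "closure {z \<in> D. ?u z < k} \<subseteq> {z. exp (- k) \<le> infdist z (- D)}"
      by (rule closure_minimal)
    moreover have "z \<in> D" if "exp (- k) \<le> infdist z (- D)" for z
      using that infdist_zero[of z "- D"] exp_gt_zero[of "- k"] by (cases "z \<in> D") auto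
    ultimately show ?thesis by blast
  qed
  have "compact (closure {z \<in> D. ?u z < k})" for k
    using bdd by (intro compact_closure[THEN iffD2] bounded_subset[OF bdd]) auto
  moreover have "continuous_plurisubharmonic_on ?u D"
    using continuous_plurisubharmonic_on_neg_ln_infdist[OF us _ \<open>open D\<close> ne] c(1) by simp
  ultimately show ?thesis
    unfolding pseudoconvex_def using sublevel \<open>open D\<close> by (intro conjI exI[of _ ?u]) auto
qed

end
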